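(* Let $\alpha=a/b$ with $a,b\in\mathbb{Z}$, $b\neq0$. If $\mathcal{R}$ is a first order rational approximation to $\alpha$, then there exists $d\in\mathbb{Z}$ such that \[ br=as+d \] for all but finitely many $(r,s)\in\mathcal{R}$. Moreover, $\mathcal{R}$ is an infinite order rational approximation to $\alpha$.
   Context: Definition. For $N\in\mathbb{N}$, an order $N$ rational approximation of $\alpha\in\mathbb{R}$ is an infinite subset $\mathcal{R}\subset\mathbb{Z}^2$ such that there exist real numbers $\gamma_1,\dots,\gamma_N$ for which \[ \frac{r}{s}=\alpha+\gamma_1 s^{-1}+\gamma_2 s^{-2}+\dots+\gamma_N s^{-N}+o\left([|r|+|s|]^{-N}\right) \] as $|r|+|s|\to\infty$ with $(r,s)\in\mathcal{R}$. (The condition is asymptotic; it presupposes $s\ne0$ for all but finitely many $(r,s)\in\mathcal{R}$.) "First order" means $N=1$. An infinite order rational approximation of $\alpha$ is a subset $\mathcal{R}$ satisfying this condition for every $N\in\mathbb{N}$. *)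

theory Defs
  imports Complex_Main "HOL-Library.Landau_Symbols"
begin

text \<open>The filter ``\<open>\<bar>r\<bar> + \<bar>s\<bar> \<rightarrow> \<infinity>\<close> with \<open>(r, s) \<in> R\<close>''.\<close>

definition height_at_top :: "(int \<times> int) set \<Rightarrow> (int \<times> int) filter" where
  "height_at_top R = inf (filtercomap (\<lambda>(r, s). \<bar>r\<bar> + \<bar>s\<bar>) at_top) (principal R)"

text \<open>
  The second conjunct makes explicit what the expansion presupposes; without it, pairs with
  \<open>s = 0\<close> would be interpreted through the convention \<open>x / 0 = 0\<close>.
\<close>

definition rational_approximation :: "nat \<Rightarrow> real \<Rightarrow> (int \<times> int) set \<Rightarrow> bool" where
  "rational_approximation N \<alpha> R \<longleftrightarrow>
     infinite R \<and>
     finite {(r, s) \<in> R. s = 0} \<and>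
     (\<exists>\<gamma> :: nat \<Rightarrow> real.
        (\<lambda>(r, s). real_of_int r / real_of_int s
                   - (\<alpha> + (\<Sum>i = 1..N. \<gamma> i * real_of_int s powi (- int i))))
        \<in> o[height_at_top R](\<lambda>(r, s). real_of_int (\<bar>r\<bar> + \<bar>s\<bar>) powi (- int N)))"

text \<open>
  Whether \<open>N = 0\<close> is included makes no difference: the case \<open>N = 1\<close> already forces
  \<open>\<bar>s\<bar> \<rightarrow> \<infinity>\<close> and hence \<open>r / s \<rightarrow> \<alpha>\<close> along \<open>R\<close>.
\<close>

definition infinite_order_rational_approximation :: "real \<Rightarrow> (int \<times> int) set \<Rightarrow> bool" where
  "infinite_order_rational_approximation \<alpha> R \<longleftrightarrow> (\<forall>N. rational_approximation N \<alpha> R)"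

end

theory Submission imports Defs begin

text \<open>
  Multiplying the first order expansion by \<open>b s\<close> shows that the integers \<open>b r - a s\<close> tend to
  \<open>b \<gamma>\<^sub>1\<close> along \<open>R\<close>, so they eventually equal a constant \<open>d\<close>. Then \<open>r/s = \<alpha> + (d/b) s\<^sup>-\<^sup>1\<close>
  exactly, for all but finitely many pairs, which is an expansion of every order.
\<close>

text \<open>Only finitely many integer pairs have height below a given bound, and finitely many
  pairs have bounded height. Hence "eventually" along this filter is the same as "for all but
  finitely many pairs in \<open>R\<close>".\<close>

lemma eventually_height_at_top:
  "eventually P (height_at_top R) \<longleftrightarrow> finite {x \<in> R. \<not> P x}"
proof
  assume "eventually P (height_at_top R)"
  then obtain M where M: "\<And>r s. M \<le> \<bar>r\<bar> + \<bar>s\<bar> \<Longrightarrow> (r, s) \<in> R \<Longrightarrow> P (r, s)"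
    unfolding height_at_top_def eventually_inf_principal eventually_filtercomap_at_top_linorder
    by fastforce
  \<comment> \<open>\<open>M\<close> may be negative, so the box is built from its absolute
    value.\<close>
  have "{x \<in> R. \<not> P x} \<subseteq> {-\<bar>M\<bar>..\<bar>M\<bar>} \<times> {-\<bar>M\<bar>..\<bar>M\<bar>}"
    using M by force
  then show "finite {x \<in> R. \<not> P x}"
    by (rule finite_subset) auto
next
  let ?h = "\<lambda>(r, s). \<bar>r\<bar> + \<bar>s\<bar> :: int"
  assume "finite {x \<in> R. \<not> P x}"
  then have "bdd_above (?h ` {x \<in> R. \<not> P x})"
    by simp
  then obtain M where "\<forall>x \<in> {x \<in> R. \<not> P x}. ?h x \<le> M"
    unfolding bdd_above.unfold by blast
  then have "\<forall>x. M + 1 \<le> ?h x \<longrightarrow> x \<in> R \<longrightarrow> P x"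
    by fastforce
  then show "eventually P (height_at_top R)"
    unfolding height_at_top_def eventually_inf_principal eventually_filtercomap_at_top_linorder
    by blast
qed

lemma first_order_eventually_linear:
  fixes a b :: int
  assumes "b \<noteq> 0" and "rational_approximation 1 (real_of_int a / real_of_int b) R"
  shows "\<exists>d. eventually (\<lambda>(r, s). s \<noteq> 0 \<and> b * r = a * s + d) (height_at_top R)"
proof -
  from assms(2) obtain \<gamma> :: "nat \<Rightarrow> real" where
    fin: "finite {(r, s) \<in> R. s = 0}" and
    small: "(\<lambda>(r, s). real_of_int r / real_of_int s
               - (real_of_int a / real_of_int b + (\<Sum>i = 1..1. \<gamma> i * real_of_int s powi (- int i))))
        \<in> o[height_at_top R](\<lambda>(r, s). real_of_int (\<bar>r\<bar> + \<bar>s\<bar>) powi (- int 1))"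
    unfolding rational_approximation_def by blast
  \<comment> \<open>The little-o constant is chosen so that \<open>\<bar>b\<bar> * c\<close> equals
    1/4, safely below the rounding radius 1/2.\<close>
  define c where "c = 1 / (4 * \<bar>real_of_int b\<bar>)"
  have "c > 0" using assms(1) by (simp add: c_def)
  \<comment> \<open>At \<open>s = 0\<close> the quotient would be 0 by convention and denominators
    could not be cleared.\<close>
  have nz: "eventually (\<lambda>(r, s). s \<noteq> 0) (height_at_top R)"
    unfolding eventually_height_at_top using fin by (simp add: case_prod_unfold)
  \<comment> \<open>An integer within distance less than 1/2 of \<open>b * \<gamma> 1\<close> must
    be its rounding. This fixes the witness for \<open>d\<close> independently of the pair.\<close>
  have "eventually (\<lambda>(r, s). s \<noteq> 0 \<and> b * r = a * s + round (b * \<gamma> 1)) (height_at_top R)"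
    using landau_o.smallD[OF small \<open>c > 0\<close>] nz
  proof eventually_elim
    case (elim x)
    obtain r s where x: "x = (r, s)" by fastforce
    define R' S A B where defs: "R' = real_of_int r" "S = real_of_int s"
      "A = real_of_int a" "B = real_of_int b"
    have "s \<noteq> 0" using elim x by simp
    then have [simp]: "S \<noteq> 0" "B \<noteq> 0" using assms(1) by (auto simp: defs)
    have bound: "\<bar>R' / S - (A / B + \<gamma> 1 / S)\<bar> \<le> c / (\<bar>R'\<bar> + \<bar>S\<bar>)"
      using elim(1) by (simp add: x defs power_int_minus field_simps)
    have "B * R' - A * S - B * \<gamma> 1 = (B * S) * (R' / S - (A / B + \<gamma> 1 / S))"
      by (simp add: field_simps)
    then have "\<bar>B * R' - A * S - B * \<gamma> 1\<bar> = \<bar>B\<bar> * \<bar>S\<bar> * \<bar>R' / S - (A / B + \<gamma> 1 / S)\<bar>"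
      by (simp add: abs_mult)
    also have "\<dots> \<le> \<bar>B\<bar> * \<bar>S\<bar> * (c / (\<bar>R'\<bar> + \<bar>S\<bar>))"
      by (intro mult_left_mono bound) auto
    also have "\<dots> = (\<bar>B\<bar> * c) * (\<bar>S\<bar> / (\<bar>R'\<bar> + \<bar>S\<bar>))"
      by simp
    also have "\<dots> = (\<bar>S\<bar> / (\<bar>R'\<bar> + \<bar>S\<bar>)) / 4"
      using \<open>B \<noteq> 0\<close> by (simp add: c_def defs)
    \<comment> \<open>The height dominates \<open>\<bar>S\<bar>\<close>, so it absorbs the factor
      produced by clearing denominators.\<close>
    also have "\<dots> \<le> 1 / 4"
      by (intro divide_right_mono divide_le_eq_1[THEN iffD2]) auto
    finally have "\<bar>B * \<gamma> 1 - real_of_int (b * r - a * s)\<bar> < 1 / 2"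
      by (simp add: defs abs_minus_commute)
    then have "round (B * \<gamma> 1) = b * r - a * s"
      by (rule round_unique')
    with \<open>s \<noteq> 0\<close> show ?case by (simp add: x defs)
  qed
  then show ?thesis by blast
qed

text \<open>As \<open>b \<noteq> 0\<close>, a point of the line is determined by its
  \<open>s\<close>, so a bounded range of \<open>s\<close> leaves only finitely many points.\<close>

lemma filterlim_denominator_at_infinity:
  fixes a b d :: int
  assumes "b \<noteq> 0" and "eventually (\<lambda>(r, s). b * r = a * s + d) (height_at_top R)"
  shows "filterlim (\<lambda>(r, s). real_of_int s) at_infinity (height_at_top R)"
  unfolding filterlim_at_infinity[OF order.refl]
proof (intro allI impI)
  fix M :: real
  assume "0 < M"
  let ?A = "{(r, s). b * r = a * s + d \<and> \<bar>real_of_int s\<bar> < M}"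
  have "inj_on snd ?A"
    using assms(1) by (auto simp: inj_on_def) (metis mult_cancel_left)
  moreover have "snd ` ?A \<subseteq> {-\<lceil>M\<rceil>..\<lceil>M\<rceil>}"
    by auto linarith+
  then have "finite (snd ` ?A)"
    by (rule finite_subset) simp
  ultimately have "finite ?A"
    by (simp add: finite_image_iff)
  then have "eventually (\<lambda>x. x \<notin> ?A) (height_at_top R)"
    unfolding eventually_height_at_top by (rule rev_finite_subset) auto
  with assms(2) show "eventually (\<lambda>x. M \<le> norm (case x of (r, s) \<Rightarrow> real_of_int s)) (height_at_top R)"
    by eventually_elim auto
qed

lemma eventually_linear_imp_rational_approximation:
  fixes a b d :: int
  assumes "b \<noteq> 0" and "infinite R"
    and lin: "eventually (\<lambda>(r, s). s \<noteq> 0 \<and> b * r = a * s + d) (height_at_top R)"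
  shows "rational_approximation N (real_of_int a / real_of_int b) R"
proof -
  \<comment> \<open>Dividing \<open>b * r = a * s + d\<close> by \<open>b * s\<close> leaves a
    single correction term, of order 1 in the inverse of \<open>s\<close>.\<close>
  define \<gamma> :: "nat \<Rightarrow> real" where "\<gamma> i = (if i = 1 then d / b else 0)" for i
  let ?f = "\<lambda>(r, s). real_of_int r / real_of_int s
              - (real_of_int a / real_of_int b + (\<Sum>i = 1..N. \<gamma> i * real_of_int s powi (- int i)))"
  have "finite {(r, s) \<in> R. s = 0}"
    using lin unfolding eventually_height_at_top by (rule rev_finite_subset) auto
  moreover have exact: "eventually (\<lambda>(r, s). real_of_int r / s = a / b + d / b / s) (height_at_top R)"
    using lin
  proof eventually_elim
    case (elim x)
    obtain r s where x: "x = (r, s)" by fastforce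
    have "real_of_int b * r = a * s + d"
      using elim unfolding x of_int_mult[symmetric] of_int_add[symmetric] of_int_eq_iff by simp
    then show ?case
      using elim assms(1) by (simp add: x field_simps)
  qed
  have "?f \<in> o[height_at_top R](\<lambda>(r, s). real_of_int (\<bar>r\<bar> + \<bar>s\<bar>) powi (- int N))"
  \<comment> \<open>For order 0 the sum is empty, so the term \<open>d / b / s\<close> stays in the
    error and must tend to 0. For higher orders the sum contains it.\<close>
  proof (cases "N = 0")
    case True
    have "filterlim (\<lambda>(r, s). real_of_int s) at_infinity (height_at_top R)"
      using assms(1) lin
      by (intro filterlim_denominator_at_infinity[of b a d]) (auto elim: eventually_mono)
    then have "((\<lambda>x. d / b / (case x of (r, s) \<Rightarrow> real_of_int s)) \<longlongrightarrow> 0) (height_at_top R)"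
      by (rule tendsto_divide_0[OF tendsto_const])
    then have "(?f \<longlongrightarrow> 0) (height_at_top R)"
      by (rule Lim_transform_eventually) (use exact in eventually_elim, auto simp: True)
    then show ?thesis
      by (auto simp: True case_prod_unfold intro!: smalloI_tendsto)
  next
    case False
    have sum: "(\<Sum>i = 1..N. \<gamma> i * real_of_int s powi (- int i)) = d / b / s" for s
    proof -
      have "(\<Sum>i = 1..N. \<gamma> i * real_of_int s powi (- int i))
          = (\<Sum>i = 1..N. if i = 1 then d / b * real_of_int s powi (- 1) else 0)"
        by (intro sum.cong) (auto simp: \<gamma>_def)
      also have "\<dots> = d / b / s"
        using False by (simp add: power_int_minus divide_inverse)
      finally show ?thesis .
    qed
    \<comment> \<open>The error is eventually exactly zero, hence little-o of any function, whatever
      the order.\<close>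
    have "eventually (\<lambda>x. ?f x = 0) (height_at_top R)"
      using exact by eventually_elim (auto simp: sum simp del: One_nat_def)
    then show ?thesis
      by (simp add: landau_o.small.in_cong)
  qed
  ultimately show ?thesis
    using assms(2) unfolding rational_approximation_def by blast
qed

theorem proposition4p1:
  fixes \<alpha> :: real and a b :: int and R :: "(int \<times> int) set"
  assumes "\<alpha> = real_of_int a / real_of_int b"
    and "b \<noteq> 0"
    and "rational_approximation 1 \<alpha> R"
  shows "(\<exists>d :: int. finite {(r, s) \<in> R. b * r \<noteq> a * s + d}) \<and>
         infinite_order_rational_approximation \<alpha> R"
proof -
  have "infinite R"
    using assms(3) by (simp add: rational_approximation_def)
  obtain d where lin: "eventually (\<lambda>(r, s). s \<noteq> 0 \<and> b * r = a * s + d) (height_at_top R)"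
    using first_order_eventually_linear assms by blast
  then have "finite {(r, s) \<in> R. b * r \<noteq> a * s + d}"
    unfolding eventually_height_at_top by (rule rev_finite_subset) auto
  \<comment> \<open>The linear relation does not mention the order, so one \<open>d\<close> serves
    every \<open>N\<close>.\<close>
  moreover have "infinite_order_rational_approximation \<alpha> R"
    unfolding infinite_order_rational_approximation_def assms(1)
    using eventually_linear_imp_rational_approximation[OF assms(2) \<open>infinite R\<close> lin] by blast
  ultimately show ?thesis by blast
qed

end
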